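(* $\mathsf{LHS}^-$ has the finite model property, and it is decidable. That is: (i) every $\varphi\in\mathcal{L}^-$ that is satisfiable (there are a model $\mathfrak{M}=(W,R,V)$ and $s,t\in W$ with $\mathfrak{M},s,t\models\varphi$) is satisfiable in a model whose set of states $W$ is finite; and (ii) there is an algorithm which, given $\varphi\in\mathcal{L}^-$, decides whether $\varphi$ is satisfiable (equivalently, one deciding whether $\varphi$ is valid).
   Context: Let $\mathsf{L}=\{p^l_i: i\in\mathbb{N}\}$ and $\mathsf{R}=\{p^r_i: i\in\mathbb{N}\}$ be disjoint countable sets of propositional variables. The language $\mathcal{L}^-$ of $\mathsf{LHS}^-$ is given by $\varphi ::= p^l \mid p^r \mid \neg\varphi \mid \varphi\wedge\varphi \mid \Box\varphi \mid \blacksquare\varphi$ ($p^l\in\mathsf{L}$, $p^r\in\mathsf{R}$). A model is $\mathfrak{M}=(W,R,V)$ with $W$ a non-empty set, $R\subseteq W\times W$, $V:\mathsf{L}\cup\mathsf{R}\to\mathcal{P}(W)$; $R(w)=\{v:Rwv\}$. Truth at $s,t\in W$: $\mathfrak{M},s,t\models p^l$ iff $s\in V(p^l)$; $\mathfrak{M},s,t\models p^r$ iff $t\in V(p^r)$; Booleans as usual; $\mathfrak{M},s,t\models\Box\varphi$ iff $\mathfrak{M},s',t\models\varphi$ for all $s'\in R(s)$; $\mathfrak{M},s,t\models\blacksquare\varphi$ iff $\mathfrak{M},s,t'\models\varphi$ for all $t'\in R(t)$. A formula is valid if it is true at all $\mathfrak{M},s,t$; $\mathsf{LHS}^-$ is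 the set of valid $\mathcal{L}^-$-formulas. *)

theory Defs
  imports Main "HOL-Library.Nat_Bijection"
begin

datatype pvar = PL nat | PR nat

datatype fml =
    Var pvar
  | Neg fml
  | Conj fml fml
  | Box fml   \<comment> \<open>moves the left state\<close>
  | BBox fml  \<comment> \<open>moves the right state\<close>

record 'w model =
  states :: "'w set"
  rel :: "('w \<times> 'w) set"
  val :: "pvar \<Rightarrow> 'w set"

definition is_model :: "'w model \<Rightarrow> bool" where
  "is_model M \<longleftrightarrow>
     states M \<noteq> {} \<and> rel M \<subseteq> states M \<times> states M \<and> (\<forall>p. val M p \<subseteq> states M)"

fun holds :: "'w model \<Rightarrow> 'w \<Rightarrow> 'w \<Rightarrow> fml \<Rightarrow> bool" where
  "holds M s t (Var (PL i)) \<longleftrightarrow> s \<in> val M (PL i)"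
| "holds M s t (Var (PR i)) \<longleftrightarrow> t \<in> val M (PR i)"
| "holds M s t (Neg \<phi>) \<longleftrightarrow> \<not> holds M s t \<phi>"
| "holds M s t (Conj \<phi> \<psi>) \<longleftrightarrow> holds M s t \<phi> \<and> holds M s t \<psi>"
| "holds M s t (Box \<phi>) \<longleftrightarrow> (\<forall>s'. (s, s') \<in> rel M \<longrightarrow> holds M s' t \<phi>)"
| "holds M s t (BBox \<phi>) \<longleftrightarrow> (\<forall>t'. (t, t') \<in> rel M \<longrightarrow> holds M s t' \<phi>)"

text \<open>
  HOL cannot quantify over all types inside a formula, so the following notions carry the type
  \<open>'w\<close> from which the states are drawn; the set of states of a model may be any nonempty
  set of elements of \<open>'w\<close>.  An infinite \<open>'w\<close> has room for finite models of every size.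
\<close>

definition satisfiable :: "'w itself \<Rightarrow> fml \<Rightarrow> bool" where
  "satisfiable T \<phi> \<longleftrightarrow>
     (\<exists>M :: 'w model. is_model M \<and> (\<exists>s \<in> states M. \<exists>t \<in> states M. holds M s t \<phi>))"

definition finitely_satisfiable :: "'w itself \<Rightarrow> fml \<Rightarrow> bool" where
  "finitely_satisfiable T \<phi> \<longleftrightarrow>
     (\<exists>M :: 'w model. is_model M \<and> finite (states M) \<and>
        (\<exists>s \<in> states M. \<exists>t \<in> states M. holds M s t \<phi>))"

definition LHS_minus :: "'w itself \<Rightarrow> fml set" where
  "LHS_minus T =
     {\<phi>. \<forall>M :: 'w model. is_model M \<longrightarrow> (\<forall>s \<in> states M. \<forall>t \<in> states M. holds M s t \<phi>)}"

text \<open>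
  Total recursive functions of a given arity: the closure of the initial functions under
  composition, primitive recursion and minimization of regular functions.  An \<open>n\<close>-ary
  function is represented on argument lists of length \<open>n\<close>; its values on lists of any
  other length are irrelevant.
\<close>

inductive recursive :: "nat \<Rightarrow> (nat list \<Rightarrow> nat) \<Rightarrow> bool" where
  zero: "recursive n (\<lambda>xs. 0)"
| succ: "recursive 1 (\<lambda>xs. Suc (xs ! 0))"
| proj: "i < n \<Longrightarrow> recursive n (\<lambda>xs. xs ! i)"
| comp: "recursive (length gs) f \<Longrightarrow> (\<forall>g \<in> set gs. recursive n g) \<Longrightarrow>
     recursive n (\<lambda>xs. f (map (\<lambda>g. g xs) gs))"
| prec: "recursive n f \<Longrightarrow> recursive (Suc (Suc n)) g \<Longrightarrow>
     recursive (Suc n)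
       (\<lambda>xs. rec_nat (f (tl xs)) (\<lambda>k r. g (k # r # tl xs)) (hd xs))"
| mu: "recursive (Suc n) f \<Longrightarrow> (\<forall>xs. length xs = n \<longrightarrow> (\<exists>y. f (y # xs) = 0)) \<Longrightarrow>
     recursive n (\<lambda>xs. LEAST y. f (y # xs) = 0)"

definition decidable :: "nat set \<Rightarrow> bool" where
  "decidable A \<longleftrightarrow>
     (\<exists>f. recursive 1 f \<and> (\<forall>n. f [n] = (if n \<in> A then 1 else 0)))"

text \<open>Goedel numbering; the residue modulo 6 identifies the outermost constructor.\<close>

fun encode :: "fml \<Rightarrow> nat" where
  "encode (Var (PL i)) = 6 * i"
| "encode (Var (PR i)) = 6 * i + 1"
| "encode (Neg \<phi>) = 6 * encode \<phi> + 2"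
| "encode (Conj \<phi> \<psi>) = 6 * prod_encode (encode \<phi>, encode \<psi>) + 3"
| "encode (Box \<phi>) = 6 * encode \<phi> + 4"
| "encode (BBox \<phi>) = 6 * encode \<phi> + 5"

lemma inj_encode: "inj encode"
proof (rule injI)
  fix \<phi> \<psi> assume "encode \<phi> = encode \<psi>"
  then show "\<phi> = \<psi>"
  proof (induction \<phi> arbitrary: \<psi> rule: encode.induct)
    case (1 i) then show ?case by (cases \<psi> rule: encode.cases) (simp_all, presburger+)
  next
    case (2 i) then show ?case by (cases \<psi> rule: encode.cases) (simp_all, presburger+)
  next
    case (3 \<phi>) then show ?case by (cases \<psi> rule: encode.cases) (simp_all, presburger+)
  next
    case (4 \<phi>1 \<phi>2) then show ?case by (cases \<psi> rule: encode.cases) (simp_all, presburger+)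
  next
    case (5 \<phi>) then show ?case by (cases \<psi> rule: encode.cases) (simp_all, presburger+)
  next
    case (6 \<phi>) then show ?case by (cases \<psi> rule: encode.cases) (simp_all, presburger+)
  qed
qed

lemma surj_encode: "\<exists>\<phi>. encode \<phi> = n"
proof (induction n rule: less_induct)
  case (less n)
  define m where "m = n div 6"
  have n: "n = 6 * m + n mod 6" by (simp add: m_def)
  consider "n = 6 * m" | "n = 6 * m + 1" | "n = 6 * m + 2" | "n = 6 * m + 3"
    | "n = 6 * m + 4" | "n = 6 * m + 5"
    using n by fastforce
  then show ?case
  proof cases
    case 1 then show ?thesis by (metis encode.simps(1))
  next
    case 2 then show ?thesis by (metis encode.simps(2))
  next
    case 3
    then obtain \<phi> where "encode \<phi> = m" using less.IH[of m] by auto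
    then show ?thesis using 3 by (metis encode.simps(3))
  next
    case 4
    obtain a b where ab: "m = prod_encode (a, b)"
      by (metis prod_decode_inverse surj_pair)
    have "a \<le> m" "b \<le> m" using ab le_prod_encode_1 le_prod_encode_2 by auto
    then obtain \<phi> \<psi> where "encode \<phi> = a" "encode \<psi> = b"
      using less.IH[of a] less.IH[of b] 4 by auto
    then show ?thesis using 4 ab by (metis encode.simps(4))
  next
    case 5
    then obtain \<phi> where "encode \<phi> = m" using less.IH[of m] by auto
    then show ?thesis using 5 by (metis encode.simps(5))
  next
    case 6
    then obtain \<phi> where "encode \<phi> = m" using less.IH[of m] by auto
    then show ?thesis using 6 by (metis encode.simps(6))
  qed
qed

lemma bij_encode: "bij encode"
  using inj_encode surj_encode by (auto simp: bij_def surj_def) (metis)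

end

theory Submission
  imports Defs
begin

text \<open>
  A formula sees each of the two current states only through its unravelling, and the unravelling
  only down to a bounded depth and through finitely many variables.  Such a
  truncated, extensionally quotiented tree is a hereditarily finite set: a finite set of indices
  of variables together with a finite set of smaller trees.  Ackermann's coding turns these trees
  into natural numbers, so that a single model on the naturals, \<open>hf_model\<close>, realizes all of
  them.  The left and the right state are evaluated independently, hence they may be coded
  separately, one reading its labels as left variables and the other as right variables
  (\<open>holds_hf_code\<close>).  Successors in \<open>hf_model\<close> are smaller than their predecessors; so the
  initial segment below the two codes is a finite model, and any infinite type contains a copy of
  it (\<open>finitely_satisfiable_if_hf_model\<close>).

  The codes of a given depth and label range are bounded (\<open>hf_code_le\<close>), so satisfiability of
  a formula amounts to its truth in \<open>hf_model\<close> at a pair of states below an explicit recursive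
  bound \<open>K\<close>.  To evaluate truth recursively, no course-of-values recursion is needed: a finite
  set \<open>T\<close> of triples (formula, left state, right state) that obeys the truth clauses up to
  \<open>K\<close> necessarily coincides with truth up to \<open>K\<close> (\<open>truth_table_holds\<close>), obeying them
  is expressible with bounded quantifiers (\<open>recursive_pred_truth_table\<close>), and such a set exists for
  every \<open>K\<close> (\<open>ex_truth_table\<close>).  Minimization therefore finds a truth table, and satisfiability is read
  off from it by a bounded search.  Validity is unsatisfiability of the negation.
\<close>

section \<open>A universal model of hereditarily finite sets\<close>

text \<open>
  A number codes the pair of a finite set of labels and a finite set of children.  The same label
  \<open>i\<close> interprets both \<open>PL i\<close> and \<open>PR i\<close>: a left state is never asked about right
  variables, nor a right state about left variables.
\<close>

fun pvar_index :: "pvar \<Rightarrow> nat" where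
  "pvar_index (PL i) = i"
| "pvar_index (PR i) = i"

definition true_at :: "nat \<Rightarrow> nat \<Rightarrow> bool" where
  "true_at i x \<longleftrightarrow> i \<in> set_decode (fst (prod_decode x))"

definition child :: "nat \<Rightarrow> nat \<Rightarrow> bool" where
  "child x y \<longleftrightarrow> y \<in> set_decode (snd (prod_decode x))"

definition hf_model :: "nat model" where
  "hf_model = \<lparr>states = UNIV, rel = {(x, y). child x y}, val = (\<lambda>p. {x. true_at (pvar_index p) x})\<rparr>"

lemma val_hf_model [simp]: "x \<in> val hf_model p \<longleftrightarrow> true_at (pvar_index p) x"
  by (simp add: hf_model_def)

lemma rel_hf_model [simp]: "(x, y) \<in> rel hf_model \<longleftrightarrow> child x y"
  by (simp add: hf_model_def)

lemma set_decode_less: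
  assumes "x \<in> set_decode z"
  shows "x < z"
proof (rule ccontr)
  assume "\<not> x < z"
  then have "z < 2 ^ x" using less_exp[of x] by linarith
  then show False using assms by (simp add: set_decode_def)
qed

lemma child_less:
  assumes "child x y"
  shows "y < x"
proof -
  obtain A S where x: "x = prod_encode (A, S)" by (metis prod_decode_inverse surj_pair)
  have "y < S" using assms x by (auto simp: child_def intro: set_decode_less)
  then show ?thesis using le_prod_encode_2[of S A] x by simp
qed

lemma all_child_le_iff: "(\<forall>y\<le>x. child x y \<longrightarrow> Q y) \<longleftrightarrow> (\<forall>y. child x y \<longrightarrow> Q y)"
  using child_less less_imp_le by blast

text \<open>
  Since children are smaller than their parents, \<open>{..k}\<close> is a generated submodel of
  \<open>hf_model\<close>, and truth is preserved by passing to it and by renaming its states.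
\<close>

lemma finitely_satisfiable_if_hf_model:
  assumes inf: "infinite (UNIV :: 'a set)" and \<phi>: "holds hf_model x y \<phi>"
  shows "finitely_satisfiable TYPE('a) \<phi>"
proof -
  obtain f :: "nat \<Rightarrow> 'a" where f: "inj f"
    using infinite_countable_subset[OF inf] by blast
  define k where "k = max x y"
  define M :: "'a model" where
    "M = \<lparr>states = f ` {..k}, rel = {(f u, f v) | u v. u \<le> k \<and> child u v},
          val = (\<lambda>p. f ` {u. u \<le> k \<and> true_at (pvar_index p) u})\<rparr>"
  have rel: "(f u, w) \<in> rel M \<longleftrightarrow> (\<exists>v. w = f v \<and> child u v)" if "u \<le> k" for u w
    using that f by (auto simp: M_def dest: injD)
  have val: "f u \<in> val M p \<longleftrightarrow> true_at (pvar_index p) u" if "u \<le> k" for u p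
    using that f by (auto simp: M_def dest: injD)
  have model: "is_model M"
    by (fastforce simp: is_model_def M_def dest: child_less)
  have truth: "holds M (f u) (f v) \<psi> \<longleftrightarrow> holds hf_model u v \<psi>" if "u \<le> k" "v \<le> k" for u v \<psi>
    using that
  proof (induction \<psi> arbitrary: u v)
    case (Var p)
    then show ?case by (cases p) (simp_all add: val)
  next
    case (Box \<psi>)
    have "holds M (f u') (f v) \<psi> \<longleftrightarrow> holds hf_model u' v \<psi>" if "child u u'" for u'
      using Box child_less[OF that] by simp
    then show ?case using Box.prems by (auto simp: rel)
  next
    case (BBox \<psi>)
    have "holds M (f u) (f v') \<psi> \<longleftrightarrow> holds hf_model u v' \<psi>" if "child v v'" for v'
      using BBox child_less[OF that] by simp
    then show ?case using BBox.prems by (auto simp: rel)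
  qed simp_all
  have "f x \<in> states M" "f y \<in> states M" "finite (states M)"
    by (auto simp: M_def k_def)
  moreover have "holds M (f x) (f y) \<phi>"
    using truth[of x y] \<phi> by (simp add: k_def)
  ultimately show ?thesis
    using model unfolding finitely_satisfiable_def by blast
qed


section \<open>Coding bounded unravellings\<close>

text \<open>
  The parameter \<open>P\<close> is \<open>PL\<close> or \<open>PR\<close>, according to the side on which the state is used;
  only the labels up to \<open>N\<close> and the successors up to depth \<open>d\<close> are recorded.
\<close>

fun hf_code :: "(nat \<Rightarrow> pvar) \<Rightarrow> 'w model \<Rightarrow> nat \<Rightarrow> nat \<Rightarrow> 'w \<Rightarrow> nat" where
  "hf_code P M N 0 s = prod_encode (set_encode {i. i \<le> N \<and> s \<in> val M (P i)}, 0)"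
| "hf_code P M N (Suc d) s =
     prod_encode (set_encode {i. i \<le> N \<and> s \<in> val M (P i)},
                  set_encode (hf_code P M N d ` {s'. (s, s') \<in> rel M}))"

definition code_bound :: "nat \<Rightarrow> nat \<Rightarrow> nat" where
  "code_bound N d =
     rec_nat (prod_encode (2 ^ Suc N, 0)) (\<lambda>k r. prod_encode (2 ^ Suc N, 2 ^ Suc r)) d"

lemma prod_encode_mono:
  assumes "a \<le> a'" and "b \<le> b'"
  shows "prod_encode (a, b) \<le> prod_encode (a', b')"
proof -
  have "triangle (a + b) \<le> triangle (a' + b')"
    using assms unfolding triangle_def by (intro div_le_mono mult_le_mono) auto
  then show ?thesis using assms by (simp add: prod_encode_def)
qed

lemma set_encode_le:
  assumes "A \<subseteq> {..k}"
  shows "set_encode A \<le> 2 ^ Suc k"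
proof -
  have "set_encode A \<le> sum ((^) 2) {..k}"
    unfolding set_encode_def using assms by (intro sum_mono2) auto
  also have "\<dots> \<le> 2 ^ Suc k"
    by (induction k) auto
  finally show ?thesis .
qed

text \<open>
  The bound does not depend on the model.  It also makes the set of codes of the successors of a
  state finite, however many successors there are, so that \<open>set_encode\<close> is faithful on it.
\<close>

lemma hf_code_le: "hf_code P M N d s \<le> code_bound N d"
proof (induction d arbitrary: s)
  case 0
  show ?case
    by (auto simp: code_bound_def simp del: power_Suc intro!: prod_encode_mono set_encode_le)
next
  case (Suc d)
  have "hf_code P M N d ` {s'. (s, s') \<in> rel M} \<subseteq> {..code_bound N d}"
    using Suc.IH by auto
  then show ?case
    using prod_encode_mono[OF set_encode_le[of "{i. i \<le> N \<and> s \<in> val M (P i)}" N] set_encode_le]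
    by (auto simp: code_bound_def simp del: power_Suc)
qed

lemma true_at_hf_code [simp]: "true_at i (hf_code P M N d s) \<longleftrightarrow> i \<le> N \<and> s \<in> val M (P i)"
  by (cases d) (simp_all add: true_at_def)

lemma child_hf_code:
  "child (hf_code P M N (Suc d) s) x \<longleftrightarrow> (\<exists>s'. (s, s') \<in> rel M \<and> x = hf_code P M N d s')"
proof -
  have "hf_code P M N d ` {s'. (s, s') \<in> rel M} \<subseteq> {..code_bound N d}"
    using hf_code_le by auto
  then have "finite (hf_code P M N d ` {s'. (s, s') \<in> rel M})"
    by (rule finite_subset) simp
  then show ?thesis by (auto simp: child_def)
qed

text \<open>
  The Goedel number of a formula bounds both its modal depths and the indices of its variables,
  and strictly decreases from a boxed formula to its body; so it can serve for all of these
  measures at once.  Each modality consumes depth on its own side only.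
\<close>

lemma holds_hf_code:
  assumes "encode \<phi> \<le> N" "encode \<phi> \<le> d" "encode \<phi> \<le> e"
  shows "holds hf_model (hf_code PL M N d s) (hf_code PR M N e t) \<phi> \<longleftrightarrow> holds M s t \<phi>"
  using assms
proof (induction \<phi> arbitrary: d e s t)
  case (Var p)
  then show ?case by (cases p) simp_all
next
  case (Neg \<phi>)
  then show ?case by simp
next
  case (Conj \<phi> \<psi>)
  have "encode \<phi> \<le> encode (Conj \<phi> \<psi>)" "encode \<psi> \<le> encode (Conj \<phi> \<psi>)"
    using le_prod_encode_1[of "encode \<phi>" "encode \<psi>"] le_prod_encode_2[of "encode \<psi>" "encode \<phi>"]
    by simp_all
  then show ?case using Conj by (simp del: encode.simps)
next
  case (Box \<phi>)
  then obtain d' where "d = Suc d'" by (cases d) auto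
  then show ?case using Box by (auto simp: child_hf_code simp del: hf_code.simps)
next
  case (BBox \<phi>)
  then obtain e' where "e = Suc e'" by (cases e) auto
  then show ?case using BBox by (auto simp: child_hf_code simp del: hf_code.simps)
qed

lemma hf_model_if_satisfiable:
  assumes "satisfiable TYPE('w) \<phi>" and B: "B = code_bound (encode \<phi>) (encode \<phi>)"
  shows "\<exists>x\<le>B. \<exists>y\<le>B. holds hf_model x y \<phi>"
proof -
  obtain M :: "'w model" and s t where "holds M s t \<phi>"
    using assms(1) unfolding satisfiable_def by blast
  then have "holds hf_model (hf_code PL M (encode \<phi>) (encode \<phi>) s)
      (hf_code PR M (encode \<phi>) (encode \<phi>) t) \<phi>"
    by (simp add: holds_hf_code)
  moreover have "hf_code P M (encode \<phi>) (encode \<phi>) u \<le> B" for P u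
    unfolding B by (rule hf_code_le)
  ultimately show ?thesis by metis
qed


section \<open>Closure properties of the recursive functions\<close>

text \<open>
  Only the values on lists of the right length matter, so recursiveness is relaxed to
  agreement with a recursive function on those lists.  Arguments are written \<open>hd xs\<close>,
  \<open>hd (tl xs)\<close> and so on, because a binder pushes its variable onto the front of the
  argument list: the body under the binder is then again of the same form, and the closure
  properties below can be applied as introduction rules.
\<close>

definition recursive_fun :: "nat \<Rightarrow> (nat list \<Rightarrow> nat) \<Rightarrow> bool" where
  "recursive_fun n f \<longleftrightarrow> (\<exists>g. recursive n g \<and> (\<forall>xs. length xs = n \<longrightarrow> g xs = f xs))"

definition recursive_pred :: "nat \<Rightarrow> (nat list \<Rightarrow> bool) \<Rightarrow> bool" where
  "recursive_pred n P \<longleftrightarrow> recursive_fun n (\<lambda>xs. of_bool (P xs))"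

named_theorems rec_intros

lemma recursive_fun_cong:
  assumes "recursive_fun n f" and "\<And>xs. length xs = n \<Longrightarrow> f xs = g xs"
  shows "recursive_fun n g"
  using assms unfolding recursive_fun_def by metis

lemma recursive_fun_if_recursive: "recursive n f \<Longrightarrow> recursive_fun n f"
  unfolding recursive_fun_def by blast

lemma recursive_fun_comp:
  assumes f: "recursive_fun (length gs) f" and gs: "\<And>g. g \<in> set gs \<Longrightarrow> recursive_fun n g"
  shows "recursive_fun n (\<lambda>xs. f (map (\<lambda>g. g xs) gs))"
proof -
  obtain f' where f': "recursive (length gs) f'" "\<And>xs. length xs = length gs \<Longrightarrow> f' xs = f xs"
    using f unfolding recursive_fun_def by blast
  have "\<forall>g \<in> set gs. \<exists>g'. recursive n g' \<and> (\<forall>xs. length xs = n \<longrightarrow> g' xs = g xs)"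
    using gs unfolding recursive_fun_def by blast
  then obtain h where h: "\<And>g. g \<in> set gs \<Longrightarrow> recursive n (h g)"
    "\<And>g xs. g \<in> set gs \<Longrightarrow> length xs = n \<Longrightarrow> h g xs = g xs"
    by metis
  have "recursive n (\<lambda>xs. f' (map (\<lambda>g. g xs) (map h gs)))"
    using f' h by (intro recursive.comp) auto
  moreover have "f' (map (\<lambda>g. g xs) (map h gs)) = f (map (\<lambda>g. g xs) gs)" if "length xs = n" for xs
  proof -
    have "map (\<lambda>g. g xs) (map h gs) = map (\<lambda>g. g xs) gs" using h that by simp
    then show ?thesis using f'(2) by (simp only: length_map)
  qed
  ultimately show ?thesis unfolding recursive_fun_def by blast
qed

lemma recursive_fun_lift1:
  assumes "recursive_fun 1 (\<lambda>xs. F (hd xs))" "recursive_fun n f"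
  shows "recursive_fun n (\<lambda>xs. F (f xs))"
  using recursive_fun_comp[of "[f]" "\<lambda>xs. F (hd xs)" n] assms by simp

lemma recursive_fun_lift2:
  assumes "recursive_fun 2 (\<lambda>xs. F (hd xs) (hd (tl xs)))" "recursive_fun n f" "recursive_fun n g"
  shows "recursive_fun n (\<lambda>xs. F (f xs) (g xs))"
  using recursive_fun_comp[of "[f, g]" "\<lambda>xs. F (hd xs) (hd (tl xs))" n] assms by (auto simp: numeral_2_eq_2)

lemma recursive_pred_lift2:
  assumes "recursive_pred 2 (\<lambda>xs. P (hd xs) (hd (tl xs)))" "recursive_fun n f" "recursive_fun n g"
  shows "recursive_pred n (\<lambda>xs. P (f xs) (g xs))"
  using assms unfolding recursive_pred_def by (rule recursive_fun_lift2)

lemma recursive_fun_nth: "i < n \<Longrightarrow> recursive_fun n (\<lambda>xs. xs ! i)"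
  by (intro recursive_fun_if_recursive recursive.proj)

lemma recursive_fun_var:
  assumes "k < n"
  shows "recursive_fun n (\<lambda>xs. hd ((tl ^^ k) xs))"
proof (rule recursive_fun_cong[OF recursive_fun_nth[OF assms]])
  fix xs :: "nat list" assume "length xs = n"
  moreover have "(tl ^^ k) xs = drop k xs"
    by (induction k) (simp_all add: drop_Suc tl_drop)
  ultimately show "xs ! k = hd ((tl ^^ k) xs)"
    using assms by (simp add: hd_drop_conv_nth)
qed

text \<open>
  Six positions suffice: two parameters under four nested quantifiers, in the definition of truth
  tables, is the deepest context that occurs.
\<close>

lemmas recursive_fun_vars [rec_intros] =
  recursive_fun_var[of 0, simplified] recursive_fun_var[of "Suc 0", simplified]
  recursive_fun_var[of "Suc (Suc 0)", simplified] recursive_fun_var[of "Suc (Suc (Suc 0))", simplified]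
  recursive_fun_var[of "Suc (Suc (Suc (Suc 0)))", simplified]
  recursive_fun_var[of "Suc (Suc (Suc (Suc (Suc 0))))", simplified]

lemma recursive_fun_Suc [rec_intros]:
  assumes "recursive_fun n f"
  shows "recursive_fun n (\<lambda>xs. Suc (f xs))"
proof -
  have "recursive_fun 1 (\<lambda>xs. Suc (hd xs))"
    by (rule recursive_fun_cong[OF recursive_fun_if_recursive[OF recursive.succ]]) (auto simp: length_Suc_conv)
  then show ?thesis using assms by (rule recursive_fun_lift1)
qed

lemma recursive_fun_const [rec_intros]: "recursive_fun n (\<lambda>xs. c)"
  by (induction c) (auto intro: recursive_fun_if_recursive recursive.zero recursive_fun_Suc)

lemma recursive_fun_Cons:
  assumes f: "recursive_fun (Suc n) f" and b: "recursive_fun n b"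
  shows "recursive_fun n (\<lambda>xs. f (b xs # xs))"
proof -
  let ?gs = "b # map (\<lambda>i xs. xs ! i) [0..<n]"
  have "recursive_fun n (\<lambda>xs. f (map (\<lambda>g. g xs) ?gs))"
    by (rule recursive_fun_comp) (use f b in \<open>auto intro: recursive_fun_nth\<close>)
  then show ?thesis
  proof (rule recursive_fun_cong)
    fix xs :: "nat list" assume "length xs = n"
    then have "map (\<lambda>g. g xs) ?gs = b xs # xs" using map_nth[of xs] by (simp add: comp_def)
    then show "f (map (\<lambda>g. g xs) ?gs) = f (b xs # xs)" by simp
  qed
qed

lemma recursive_fun_tl:
  assumes "recursive_fun n f"
  shows "recursive_fun (Suc n) (\<lambda>xs. f (tl xs))"
proof -
  let ?gs = "map (\<lambda>i xs. xs ! Suc i) [0..<n]"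
  have "recursive_fun (Suc n) (\<lambda>xs. f (map (\<lambda>g. g xs) ?gs))"
    by (rule recursive_fun_comp) (use assms in \<open>auto intro: recursive_fun_nth\<close>)
  then show ?thesis
  proof (rule recursive_fun_cong)
    fix xs :: "nat list" assume "length xs = Suc n"
    then have "map (\<lambda>g. g xs) ?gs = tl xs"
      by (intro nth_equalityI) (simp_all add: nth_tl)
    then show "f (map (\<lambda>g. g xs) ?gs) = f (tl xs)" by simp
  qed
qed

lemma recursive_fun_rec_nat:
  assumes f: "recursive_fun n f" and g: "recursive_fun (Suc (Suc n)) (\<lambda>ys. g (hd ys) (hd (tl ys)) (tl (tl ys)))"
    and b: "recursive_fun n b"
  shows "recursive_fun n (\<lambda>xs. rec_nat (f xs) (\<lambda>k r. g k r xs) (b xs))"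
proof -
  obtain f' where f': "recursive n f'" "\<And>xs. length xs = n \<Longrightarrow> f' xs = f xs"
    using f unfolding recursive_fun_def by blast
  obtain g' where g': "recursive (Suc (Suc n)) g'"
    "\<And>ys. length ys = Suc (Suc n) \<Longrightarrow> g' ys = g (hd ys) (hd (tl ys)) (tl (tl ys))"
    using g unfolding recursive_fun_def by blast
  have "recursive_fun (Suc n) (\<lambda>xs. rec_nat (f' (tl xs)) (\<lambda>k r. g' (k # r # tl xs)) (hd xs))"
    using f' g' by (intro recursive_fun_if_recursive recursive.prec)
  from recursive_fun_Cons[OF this b] show ?thesis
    by (rule recursive_fun_cong) (simp add: f' g')
qed

lemma recursive_fun_LEAST:
  assumes f: "recursive_fun (Suc n) (\<lambda>ys. f (hd ys) (tl ys))"
    and ex: "\<And>xs. length xs = n \<Longrightarrow> \<exists>y. f y xs = 0"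
  shows "recursive_fun n (\<lambda>xs. LEAST y. f y xs = 0)"
proof -
  obtain f' where f': "recursive (Suc n) f'"
    "\<And>ys. length ys = Suc n \<Longrightarrow> f' ys = f (hd ys) (tl ys)"
    using f unfolding recursive_fun_def by blast
  have "recursive n (\<lambda>xs. LEAST y. f' (y # xs) = 0)"
    using f' ex by (intro recursive.mu) auto
  then have "recursive_fun n (\<lambda>xs. LEAST y. f' (y # xs) = 0)" by (rule recursive_fun_if_recursive)
  then show ?thesis by (rule recursive_fun_cong) (simp add: f')
qed


subsection \<open>Arithmetic\<close>

lemma recursive_fun_add [rec_intros]:
  assumes "recursive_fun n f" "recursive_fun n g"
  shows "recursive_fun n (\<lambda>xs. f xs + g xs)"
proof -
  have eq: "a + b = rec_nat a (\<lambda>k r. Suc r) b" for a b :: nat by (induction b) auto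
  show ?thesis unfolding eq
    by (rule recursive_fun_rec_nat) (use assms in \<open>auto intro!: rec_intros\<close>)
qed

lemma recursive_fun_mult [rec_intros]:
  assumes "recursive_fun n f" "recursive_fun n g"
  shows "recursive_fun n (\<lambda>xs. f xs * g xs)"
proof -
  have eq: "a * b = rec_nat 0 (\<lambda>k r. r + a) b" for a b :: nat by (induction b) auto
  have "recursive_fun 2 (\<lambda>xs. hd xs * hd (tl xs))" unfolding eq
    by (rule recursive_fun_rec_nat) (auto intro!: rec_intros)
  then show ?thesis using assms by (rule recursive_fun_lift2)
qed

lemma recursive_fun_power2 [rec_intros]:
  assumes "recursive_fun n f"
  shows "recursive_fun n (\<lambda>xs. 2 ^ f xs)"
proof -
  have eq: "(2 :: nat) ^ b = rec_nat 1 (\<lambda>k r. r * 2) b" for b :: nat by (induction b) auto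
  show ?thesis unfolding eq
    by (rule recursive_fun_rec_nat) (use assms in \<open>auto intro!: rec_intros\<close>)
qed

lemma recursive_fun_diff [rec_intros]:
  assumes "recursive_fun n f" "recursive_fun n g"
  shows "recursive_fun n (\<lambda>xs. f xs - g xs)"
proof -
  have eq1: "b - 1 = rec_nat 0 (\<lambda>k r. k) b" for b :: nat by (induction b) auto
  have "recursive_fun 1 (\<lambda>xs. hd xs - 1)" unfolding eq1
    by (rule recursive_fun_rec_nat) (auto intro!: rec_intros)
  note pred = recursive_fun_lift1[OF this]
  have eq: "a - b = rec_nat a (\<lambda>k r. r - 1) b" for a b :: nat by (induction b) auto
  have "recursive_fun n (\<lambda>xs. rec_nat (f xs) (\<lambda>k r. r - 1) (g xs))"
    by (intro recursive_fun_rec_nat assms pred rec_intros) simp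
  then show ?thesis by (rule recursive_fun_cong) (rule eq[symmetric])
qed

lemma recursive_fun_triangle [rec_intros]:
  assumes "recursive_fun n f"
  shows "recursive_fun n (\<lambda>xs. triangle (f xs))"
proof -
  have eq: "triangle b = rec_nat 0 (\<lambda>k r. r + Suc k) b" for b :: nat by (induction b) auto
  show ?thesis unfolding eq
    by (rule recursive_fun_rec_nat) (use assms in \<open>auto intro!: rec_intros simp del: add_Suc_right\<close>)
qed

lemma recursive_fun_prod_encode [rec_intros]:
  assumes "recursive_fun n f" "recursive_fun n g"
  shows "recursive_fun n (\<lambda>xs. prod_encode (f xs, g xs))"
  unfolding prod_encode_def prod.case by (intro rec_intros assms)

lemma recursive_fun_code_bound [rec_intros]:
  assumes "recursive_fun n f" "recursive_fun n g"
  shows "recursive_fun n (\<lambda>xs. code_bound (f xs) (g xs))"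
proof -
  have "recursive_fun 2 (\<lambda>xs. code_bound (hd xs) (hd (tl xs)))" unfolding code_bound_def
    by (rule recursive_fun_rec_nat) (auto intro!: rec_intros simp del: power_Suc)
  then show ?thesis using assms by (rule recursive_fun_lift2)
qed


subsection \<open>Predicates\<close>

lemma recursive_pred_cong:
  assumes "recursive_pred n P" and "\<And>xs. P xs \<longleftrightarrow> Q xs"
  shows "recursive_pred n Q"
proof -
  have "P = Q" using assms(2) by blast
  then show ?thesis using assms(1) by simp
qed

lemma recursive_pred_not [rec_intros]:
  assumes "recursive_pred n P"
  shows "recursive_pred n (\<lambda>xs. \<not> P xs)"
proof -
  have "recursive_fun n (\<lambda>xs. 1 - of_bool (P xs))"
    using assms unfolding recursive_pred_def by (intro rec_intros)
  then show ?thesis unfolding recursive_pred_def by (rule recursive_fun_cong) simp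
qed

lemma recursive_pred_conj [rec_intros]:
  assumes "recursive_pred n P" "recursive_pred n Q"
  shows "recursive_pred n (\<lambda>xs. P xs \<and> Q xs)"
proof -
  have "recursive_fun n (\<lambda>xs. of_bool (P xs) * of_bool (Q xs))"
    using assms unfolding recursive_pred_def by (intro rec_intros)
  then show ?thesis unfolding recursive_pred_def by (rule recursive_fun_cong) simp
qed

lemma recursive_pred_imp [rec_intros]:
  assumes "recursive_pred n P" "recursive_pred n Q"
  shows "recursive_pred n (\<lambda>xs. P xs \<longrightarrow> Q xs)"
proof -
  have "recursive_pred n (\<lambda>xs. \<not> (P xs \<and> \<not> Q xs))" using assms by (intro rec_intros)
  then show ?thesis by (rule recursive_pred_cong) blast
qed

lemma recursive_pred_iff [rec_intros]:
  assumes "recursive_pred n P" "recursive_pred n Q"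
  shows "recursive_pred n (\<lambda>xs. P xs \<longleftrightarrow> Q xs)"
proof -
  have "recursive_pred n (\<lambda>xs. (P xs \<longrightarrow> Q xs) \<and> (Q xs \<longrightarrow> P xs))" using assms by (intro rec_intros)
  then show ?thesis by (rule recursive_pred_cong) blast
qed

lemma recursive_pred_eq [rec_intros]:
  assumes "recursive_fun n f" "recursive_fun n g"
  shows "recursive_pred n (\<lambda>xs. f xs = g xs)"
proof -
  have "recursive_fun n (\<lambda>xs. 1 - ((f xs - g xs) + (g xs - f xs)))" using assms by (intro rec_intros)
  then show ?thesis unfolding recursive_pred_def by (rule recursive_fun_cong) auto
qed

lemma recursive_pred_less [rec_intros]:
  assumes "recursive_fun n f" "recursive_fun n g"
  shows "recursive_pred n (\<lambda>xs. f xs < g xs)"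
proof -
  have "recursive_pred n (\<lambda>xs. \<not> g xs - f xs = 0)" using assms by (intro rec_intros)
  then show ?thesis by (rule recursive_pred_cong) auto
qed

text \<open>
  Searching for a counterexample, with \<open>Suc (b xs)\<close> as a sentinel that stops the search,
  reduces bounded quantification to minimization.
\<close>

lemma recursive_pred_all_le [rec_intros]:
  assumes P: "recursive_pred (Suc n) (\<lambda>ys. P (hd ys) (tl ys))" and b: "recursive_fun n b"
  shows "recursive_pred n (\<lambda>xs. \<forall>y\<le>b xs. P y xs)"
proof -
  define stop where "stop = (\<lambda>y xs. of_bool (P y xs \<and> \<not> y = Suc (b xs)) :: nat)"
  have stop_iff: "stop y xs = 0 \<longleftrightarrow> \<not> P y xs \<or> y = Suc (b xs)" for y xs
    by (simp add: stop_def)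
  have "recursive_pred (Suc n) (\<lambda>ys. P (hd ys) (tl ys) \<and> \<not> hd ys = Suc (b (tl ys)))"
    by (intro rec_intros P recursive_fun_tl b) simp
  then have "recursive_fun (Suc n) (\<lambda>ys. stop (hd ys) (tl ys))"
    by (simp add: recursive_pred_def stop_def)
  then have "recursive_fun n (\<lambda>xs. LEAST y. stop y xs = 0)"
    by (rule recursive_fun_LEAST) (auto simp: stop_iff)
  then have "recursive_pred n (\<lambda>xs. (LEAST y. stop y xs = 0) = Suc (b xs))"
    by (intro rec_intros b)
  moreover have "(LEAST y. stop y xs = 0) = Suc (b xs) \<longleftrightarrow> (\<forall>y\<le>b xs. P y xs)" for xs
  proof
    assume "(LEAST y. stop y xs = 0) = Suc (b xs)"
    then show "\<forall>y\<le>b xs. P y xs"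
      using not_less_Least[of _ "\<lambda>y. stop y xs = 0"] by (auto simp: stop_iff less_Suc_eq_le)
  next
    assume "\<forall>y\<le>b xs. P y xs"
    then show "(LEAST y. stop y xs = 0) = Suc (b xs)"
      by (intro Least_equality) (auto simp: stop_iff not_less_eq_eq[symmetric])
  qed
  ultimately show ?thesis by (rule recursive_pred_cong)
qed

lemma recursive_pred_ex_le [rec_intros]:
  assumes "recursive_pred (Suc n) (\<lambda>ys. P (hd ys) (tl ys))" "recursive_fun n b"
  shows "recursive_pred n (\<lambda>xs. \<exists>y\<le>b xs. P y xs)"
proof -
  have "recursive_pred n (\<lambda>xs. \<not> (\<forall>y\<le>b xs. \<not> P y xs))" using assms by (intro rec_intros)
  then show ?thesis by (rule recursive_pred_cong) blast
qed

text \<open>Rather than defining division, the bit at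
  position \<open>x\<close> is isolated by searching for a quotient and a remainder.\<close>

lemma recursive_pred_set_decode [rec_intros]:
  assumes "recursive_fun n f" "recursive_fun n g"
  shows "recursive_pred n (\<lambda>xs. f xs \<in> set_decode (g xs))"
proof -
  have eq: "x \<in> set_decode z \<longleftrightarrow> (\<exists>q\<le>z. \<exists>r\<le>z. z = (2 * q + 1) * 2 ^ x + r \<and> r < 2 ^ x)" for x z
  proof
    assume "x \<in> set_decode z"
    then have "odd (z div 2 ^ x)" by (simp add: set_decode_def)
    then obtain q where q: "z div 2 ^ x = 2 * q + 1" by (auto elim: oddE)
    have "z div 2 ^ x \<le> z" "z mod 2 ^ x \<le> z" by simp_all
    moreover have "z = (2 * q + 1) * 2 ^ x + z mod 2 ^ x" using q by (metis div_mult_mod_eq)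
    ultimately show "\<exists>q\<le>z. \<exists>r\<le>z. z = (2 * q + 1) * 2 ^ x + r \<and> r < 2 ^ x"
      using q by (intro exI[of _ q] conjI exI[of _ "z mod 2 ^ x"]) auto
  next
    assume "\<exists>q\<le>z. \<exists>r\<le>z. z = (2 * q + 1) * 2 ^ x + r \<and> r < 2 ^ x"
    then obtain q r where "z = (2 * q + 1) * 2 ^ x + r" "r < 2 ^ x" by blast
    then have "z div 2 ^ x = 2 * q + 1" using div_mult_self3[of "2 ^ x" "2 * q + 1" r] by simp
    then show "x \<in> set_decode z" by (simp add: set_decode_def)
  qed
  have "recursive_pred 2 (\<lambda>xs. hd xs \<in> set_decode (hd (tl xs)))"
    unfolding eq by (intro rec_intros) simp_all
  then show ?thesis using assms by (rule recursive_pred_lift2)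
qed

lemma ex_prod_encode_le:
  "Q (fst (prod_decode x)) (snd (prod_decode x)) \<longleftrightarrow>
    (\<exists>A\<le>x. \<exists>S\<le>x. x = prod_encode (A, S) \<and> Q A S)"
proof -
  obtain A S where "x = prod_encode (A, S)" by (metis prod_decode_inverse surj_pair)
  then show ?thesis using le_prod_encode_1[of A S] le_prod_encode_2[of S A] by auto
qed

lemma recursive_pred_true_at [rec_intros]:
  assumes "recursive_fun n f" "recursive_fun n g"
  shows "recursive_pred n (\<lambda>xs. true_at (f xs) (g xs))"
proof -
  have eq: "true_at i x \<longleftrightarrow> (\<exists>A\<le>x. \<exists>S\<le>x. x = prod_encode (A, S) \<and> i \<in> set_decode A)" for i x
    unfolding true_at_def by (rule ex_prod_encode_le)
  have "recursive_pred 2 (\<lambda>xs. true_at (hd xs) (hd (tl xs)))"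
    unfolding eq by (intro rec_intros) simp_all
  then show ?thesis using assms by (rule recursive_pred_lift2)
qed

lemma recursive_pred_child [rec_intros]:
  assumes "recursive_fun n f" "recursive_fun n g"
  shows "recursive_pred n (\<lambda>xs. child (f xs) (g xs))"
proof -
  have eq: "child x y \<longleftrightarrow> (\<exists>A\<le>x. \<exists>S\<le>x. x = prod_encode (A, S) \<and> y \<in> set_decode S)" for x y
    unfolding child_def by (rule ex_prod_encode_le)
  have "recursive_pred 2 (\<lambda>xs. child (hd xs) (hd (tl xs)))"
    unfolding eq by (intro rec_intros) simp_all
  then show ?thesis using assms by (rule recursive_pred_lift2)
qed


section \<open>Truth tables\<close>

definition entry :: "nat \<Rightarrow> nat \<Rightarrow> nat \<Rightarrow> nat \<Rightarrow> bool" where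
  "entry T n x y \<longleftrightarrow> prod_encode (n, prod_encode (x, y)) \<in> set_decode T"

text \<open>
  The clauses are indexed by the Goedel numbers \<open>m\<close> and \<open>a\<close> of the immediate subformulas
  rather than by that of the compound formula, which spares decoding; bounding the former by
  \<open>K\<close> covers all formulas with number up to \<open>K\<close>.  Children are searched below their
  parents, where all of them lie.
\<close>

definition truth_table :: "nat \<Rightarrow> nat \<Rightarrow> bool" where
  "truth_table T K \<longleftrightarrow> (\<forall>m\<le>K. \<forall>x\<le>K. \<forall>y\<le>K.
     (entry T (6 * m) x y \<longleftrightarrow> true_at m x) \<and>
     (entry T (6 * m + 1) x y \<longleftrightarrow> true_at m y) \<and>
     (entry T (6 * m + 2) x y \<longleftrightarrow> \<not> entry T m x y) \<and>
     (\<forall>a\<le>K. entry T (6 * prod_encode (m, a) + 3) x y \<longleftrightarrow> entry T m x y \<and> entry T a x y) \<and>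
     (entry T (6 * m + 4) x y \<longleftrightarrow> (\<forall>x'\<le>x. child x x' \<longrightarrow> entry T m x' y)) \<and>
     (entry T (6 * m + 5) x y \<longleftrightarrow> (\<forall>y'\<le>y. child y y' \<longrightarrow> entry T m x y')))"

lemma recursive_pred_truth_table [rec_intros]:
  assumes "recursive_fun n f" "recursive_fun n g"
  shows "recursive_pred n (\<lambda>xs. truth_table (f xs) (g xs))"
proof -
  have "recursive_pred 2 (\<lambda>xs. truth_table (hd xs) (hd (tl xs)))"
    unfolding truth_table_def entry_def by (intro rec_intros) simp_all
  then show ?thesis using assms by (rule recursive_pred_lift2)
qed

lemma truth_table_holds:
  assumes T: "truth_table T K" and "encode \<phi> \<le> K" "x \<le> K" "y \<le> K"
  shows "entry T (encode \<phi>) x y \<longleftrightarrow> holds hf_model x y \<phi>"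
  using assms(2-)
proof (induction \<phi> arbitrary: x y)
  case (Var p)
  then show ?case using T unfolding truth_table_def by (cases p) simp_all
next
  case (Neg \<phi>)
  then have "entry T (encode (Neg \<phi>)) x y \<longleftrightarrow> \<not> entry T (encode \<phi>) x y"
    using T unfolding truth_table_def by simp
  then show ?case using Neg by simp
next
  case (Conj \<phi> \<psi>)
  have le: "encode \<phi> \<le> K" "encode \<psi> \<le> K"
    using Conj.prems le_prod_encode_1[of "encode \<phi>" "encode \<psi>"]
      le_prod_encode_2[of "encode \<psi>" "encode \<phi>"] by simp_all
  then have "entry T (encode (Conj \<phi> \<psi>)) x y \<longleftrightarrow> entry T (encode \<phi>) x y \<and> entry T (encode \<psi>) x y"
    using T Conj.prems unfolding truth_table_def by simp
  then show ?case using Conj le by simp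
next
  case (Box \<phi>)
  then have "entry T (encode (Box \<phi>)) x y \<longleftrightarrow> (\<forall>x'\<le>x. child x x' \<longrightarrow> entry T (encode \<phi>) x' y)"
    using T unfolding truth_table_def by simp
  also have "\<dots> \<longleftrightarrow> (\<forall>x'. child x x' \<longrightarrow> holds hf_model x' y \<phi>)"
  proof -
    have "entry T (encode \<phi>) x' y \<longleftrightarrow> holds hf_model x' y \<phi>" if "child x x'" for x'
      using Box child_less[OF that] by simp
    then show ?thesis by (simp add: all_child_le_iff)
  qed
  finally show ?case by simp
next
  case (BBox \<phi>)
  then have "entry T (encode (BBox \<phi>)) x y \<longleftrightarrow> (\<forall>y'\<le>y. child y y' \<longrightarrow> entry T (encode \<phi>) x y')"
    using T unfolding truth_table_def by simp
  also have "\<dots> \<longleftrightarrow> (\<forall>y'. child y y' \<longrightarrow> holds hf_model x y' \<phi>)"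
  proof -
    have "entry T (encode \<phi>) x y' \<longleftrightarrow> holds hf_model x y' \<phi>" if "child y y'" for y'
      using BBox child_less[OF that] by simp
    then show ?thesis by (simp add: all_child_le_iff)
  qed
  finally show ?case by simp
qed

lemma ex_truth_table: "\<exists>T. truth_table T K"
proof -
  \<comment> \<open>an upper bound of the formula numbers about which the clauses up to \<open>K\<close> speak\<close>
  define N where "N = 6 * prod_encode (K, K) + 5"
  define A where "A = {prod_encode (n, prod_encode (x, y)) | n x y.
    n \<le> N \<and> x \<le> K \<and> y \<le> K \<and> (\<exists>\<phi>. encode \<phi> = n \<and> holds hf_model x y \<phi>)}"
  have "A \<subseteq> (\<lambda>(n, x, y). prod_encode (n, prod_encode (x, y))) ` ({..N} \<times> {..K} \<times> {..K})"
    unfolding A_def by force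
  then have "finite A" by (rule finite_subset) simp
  then have entry: "entry (set_encode A) (encode \<phi>) x y \<longleftrightarrow> holds hf_model x y \<phi>"
    if "encode \<phi> \<le> N" "x \<le> K" "y \<le> K" for \<phi> x y
    using that inj_encode by (auto simp: entry_def A_def dest: injD)
  have "truth_table (set_encode A) K"
    unfolding truth_table_def
  proof (intro allI impI, goal_cases)
    case (1 m x y)
    obtain \<phi> where \<phi>: "encode \<phi> = m" using surj_encode by blast
    have "m \<le> prod_encode (K, K)" using 1 le_prod_encode_1[of K K] by simp
    then have m: "6 * m + 5 \<le> N" by (simp add: N_def)
    have conj: "entry (set_encode A) (6 * prod_encode (m, a) + 3) x y \<longleftrightarrow>
        entry (set_encode A) m x y \<and> entry (set_encode A) a x y" if a: "a \<le> K" for a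
    proof -
      obtain \<psi> where \<psi>: "encode \<psi> = a" using surj_encode by blast
      have "prod_encode (m, a) \<le> prod_encode (K, K)" using 1 a by (intro prod_encode_mono)
      then have "6 * prod_encode (m, a) + 3 \<le> N" "a \<le> N"
        using a le_prod_encode_1[of K K] by (simp_all add: N_def)
      then show ?thesis
        using entry[of "Conj \<phi> \<psi>" x y] entry[of \<phi> x y] entry[of \<psi> x y] 1 m \<phi> \<psi> by simp
    qed
    have box: "(\<forall>x'\<le>x. child x x' \<longrightarrow> entry (set_encode A) m x' y) \<longleftrightarrow> holds hf_model x y (Box \<phi>)"
    proof -
      have "entry (set_encode A) m x' y \<longleftrightarrow> holds hf_model x' y \<phi>" if "x' \<le> x" for x'
        using entry[of \<phi> x' y] 1 m \<phi> that by simp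
      then show ?thesis by (simp add: all_child_le_iff[symmetric])
    qed
    have bbox: "(\<forall>y'\<le>y. child y y' \<longrightarrow> entry (set_encode A) m x y') \<longleftrightarrow> holds hf_model x y (BBox \<phi>)"
    proof -
      have "entry (set_encode A) m x y' \<longleftrightarrow> holds hf_model x y' \<phi>" if "y' \<le> y" for y'
        using entry[of \<phi> x y'] 1 m \<phi> that by simp
      then show ?thesis by (simp add: all_child_le_iff[symmetric])
    qed
    show ?case
      unfolding box bbox
      using entry[of "Var (PL m)" x y] entry[of "Var (PR m)" x y] entry[of \<phi> x y]
        entry[of "Neg \<phi>" x y] entry[of "Box \<phi>" x y] entry[of "BBox \<phi>" x y] conj 1 m \<phi>
      by simp
  qed
  then show ?thesis by blast
qed


section \<open>Decidability\<close>

lemma decidable_recursive_pred: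
  assumes "recursive_pred 1 (\<lambda>xs. hd xs \<in> A)"
  shows "decidable A"
proof -
  obtain f where "recursive 1 f" "\<And>xs. length xs = 1 \<Longrightarrow> f xs = of_bool (hd xs \<in> A)"
    using assms unfolding recursive_pred_def recursive_fun_def by blast
  then show ?thesis unfolding decidable_def by (intro exI[of _ f]) simp
qed

text \<open>
  The table has to extend up to both the formula and the bound on the states, whence the sum.
\<close>

definition table_size :: "nat \<Rightarrow> nat" where
  "table_size n = n + code_bound n n"

definition table :: "nat \<Rightarrow> nat" where
  "table n = (LEAST T. of_bool (\<not> truth_table T (table_size n)) = (0 :: nat))"

lemma truth_table_table: "truth_table (table n) (table_size n)"
  using LeastI_ex[OF ex_truth_table] by (simp add: table_def)

lemma recursive_fun_table_size [rec_intros]: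
  assumes "recursive_fun n f"
  shows "recursive_fun n (\<lambda>xs. table_size (f xs))"
  unfolding table_size_def by (intro rec_intros assms)

lemma recursive_fun_table [rec_intros]:
  assumes "recursive_fun n f"
  shows "recursive_fun n (\<lambda>xs. table (f xs))"
proof -
  have "recursive_pred (Suc 1) (\<lambda>ys. \<not> truth_table (hd ys) (table_size (hd (tl ys))))"
    by (intro rec_intros) simp_all
  then have "recursive_fun 1 (\<lambda>xs. table (hd xs))"
    unfolding table_def
    by (intro recursive_fun_LEAST) (simp_all add: recursive_pred_def ex_truth_table)
  then show ?thesis using assms by (rule recursive_fun_lift1)
qed

definition sat_number :: "nat \<Rightarrow> bool" where
  "sat_number n \<longleftrightarrow> (\<exists>x\<le>table_size n. \<exists>y\<le>table_size n. entry (table n) n x y)"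

lemma recursive_pred_sat_number:
  assumes "recursive_fun n f"
  shows "recursive_pred n (\<lambda>xs. sat_number (f xs))"
proof -
  have "recursive_fun 1 (\<lambda>xs. of_bool (sat_number (hd xs)))"
    unfolding recursive_pred_def[symmetric] sat_number_def entry_def by (intro rec_intros) simp_all
  then show ?thesis unfolding recursive_pred_def using assms by (rule recursive_fun_lift1)
qed

lemma sat_number_encode:
  assumes "infinite (UNIV :: 'a set)"
  shows "sat_number (encode \<phi>) \<longleftrightarrow> satisfiable TYPE('a) \<phi>"
proof -
  have "entry (table (encode \<phi>)) (encode \<phi>) x y \<longleftrightarrow> holds hf_model x y \<phi>"
    if "x \<le> table_size (encode \<phi>)" "y \<le> table_size (encode \<phi>)" for x y
    using truth_table_holds[OF truth_table_table _ that] by (simp add: table_size_def)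
  then have "sat_number (encode \<phi>) \<longleftrightarrow>
      (\<exists>x\<le>table_size (encode \<phi>). \<exists>y\<le>table_size (encode \<phi>). holds hf_model x y \<phi>)"
    unfolding sat_number_def by blast
  also have "\<dots> \<longleftrightarrow> satisfiable TYPE('a) \<phi>"
  proof
    assume "\<exists>x\<le>table_size (encode \<phi>). \<exists>y\<le>table_size (encode \<phi>). holds hf_model x y \<phi>"
    then have "finitely_satisfiable TYPE('a) \<phi>"
      using finitely_satisfiable_if_hf_model[OF assms] by blast
    then show "satisfiable TYPE('a) \<phi>"
      unfolding satisfiable_def finitely_satisfiable_def by blast
  next
    assume "satisfiable TYPE('a) \<phi>"
    from hf_model_if_satisfiable[OF this refl]
    show "\<exists>x\<le>table_size (encode \<phi>). \<exists>y\<le>table_size (encode \<phi>). holds hf_model x y \<phi>"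
      by (auto simp: table_size_def intro: trans_le_add2)
  qed
  finally show ?thesis .
qed

lemma LHS_minus_iff: "\<phi> \<in> LHS_minus TYPE('a) \<longleftrightarrow> \<not> satisfiable TYPE('a) (Neg \<phi>)"
  unfolding LHS_minus_def satisfiable_def by auto

theorem theorem6:
  assumes "infinite (UNIV :: 'a set)"
  shows "(\<forall>\<phi>. satisfiable TYPE('b) \<phi> \<longrightarrow> finitely_satisfiable TYPE('a) \<phi>) \<and>
         decidable (encode ` {\<phi>. satisfiable TYPE('a) \<phi>}) \<and>
         decidable (encode ` LHS_minus TYPE('a))"
proof (intro conjI allI impI)
  fix \<phi> assume "satisfiable TYPE('b) \<phi>"
  from hf_model_if_satisfiable[OF this refl] show "finitely_satisfiable TYPE('a) \<phi>"
    using finitely_satisfiable_if_hf_model[OF assms] by blast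
next
  have "n \<in> encode ` {\<phi>. satisfiable TYPE('a) \<phi>} \<longleftrightarrow> sat_number n" for n
    using sat_number_encode[OF assms] surj_encode[of n] inj_image_mem_iff[OF inj_encode]
    by auto
  then have "(hd xs \<in> encode ` {\<phi>. satisfiable TYPE('a) \<phi>}) \<longleftrightarrow> sat_number (hd xs)" for xs
    by blast
  moreover have "recursive_pred 1 (\<lambda>xs. sat_number (hd xs))"
    by (intro rec_intros recursive_pred_sat_number) simp
  ultimately show "decidable (encode ` {\<phi>. satisfiable TYPE('a) \<phi>})"
    by (intro decidable_recursive_pred) simp
next
  have "n \<in> encode ` LHS_minus TYPE('a) \<longleftrightarrow> \<not> sat_number (6 * n + 2)" for n
  proof -
    obtain \<phi> where \<phi>: "encode \<phi> = n" using surj_encode by blast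
    have "n \<in> encode ` LHS_minus TYPE('a) \<longleftrightarrow> \<phi> \<in> LHS_minus TYPE('a)"
      using inj_image_mem_iff[OF inj_encode] \<phi> by auto
    then show ?thesis
      using sat_number_encode[OF assms, of "Neg \<phi>"] \<phi> by (simp add: LHS_minus_iff)
  qed
  then have "(hd xs \<in> encode ` LHS_minus TYPE('a)) \<longleftrightarrow> \<not> sat_number (6 * hd xs + 2)" for xs
    by blast
  moreover have "recursive_pred 1 (\<lambda>xs. \<not> sat_number (6 * hd xs + 2))"
    by (intro rec_intros recursive_pred_sat_number) simp
  ultimately show "decidable (encode ` LHS_minus TYPE('a))"
    by (intro decidable_recursive_pred) simp
qed

end
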